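(* Let $m,n_1,n_2$ be positive integers with $n_1\ge m-2\ge n_2\ge 2$ and $2\mid mn_1$. If $$n_1>m-5+n_2+\frac{(n_2-1)(n_2-2)}{m-1-n_2},$$ then $r(K_{1,m-1},S(n_1,n_2))=m+n_1$.
   Context: All graphs are finite simple graphs. For graphs $G_1,G_2$, the Ramsey number $r(G_1,G_2)$ is the smallest positive integer $N$ such that for every graph $G$ on $N$ vertices, either $G$ contains a (not necessarily induced) subgraph isomorphic to $G_1$, or the complement $\overline{G}$ contains a subgraph isomorphic to $G_2$. $K_{1,m-1}$ is the star on $m$ vertices. For positive integers $n_1\ge n_2$, the double star $S(n_1,n_2)$ is the tree with vertex set $\{v_0,v_1,\ldots,v_{n_1},w_0,w_1,\ldots,w_{n_2}\}$ and edge set $\{v_0v_1,\ldots,v_0v_{n_1},v_0w_0,w_0w_1,\ldots,w_0w_{n_2}\}$. *)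

theory Defs
  imports Complex_Main "HOL-Library.Ramsey"
begin

(* A graph is a pair (V, E); an edge is a two-element set of vertices, and
   [V]\<^bsup>2\<^esup> (nsets V 2) is the set of all two-element subsets of V. *)
type_synonym 'a graph = "'a set \<times> 'a set set"

abbreviation vertices :: "'a graph \<Rightarrow> 'a set" where
  "vertices \<equiv> fst"

abbreviation edges :: "'a graph \<Rightarrow> 'a set set" where
  "edges \<equiv> snd"

definition simple_graph :: "'a graph \<Rightarrow> bool" where
  "simple_graph G \<longleftrightarrow> finite (vertices G) \<and> edges G \<subseteq> [vertices G]\<^bsup>2\<^esup>"

definition complement :: "'a graph \<Rightarrow> 'a graph" where
  "complement G = (vertices G, [vertices G]\<^bsup>2\<^esup> - edges G)"

definition subgraph :: "'a graph \<Rightarrow> 'a graph \<Rightarrow> bool" where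
  "subgraph H G \<longleftrightarrow> simple_graph H \<and> vertices H \<subseteq> vertices G \<and> edges H \<subseteq> edges G"

definition isomorphic :: "'a graph \<Rightarrow> 'b graph \<Rightarrow> bool" where
  "isomorphic G H \<longleftrightarrow>
     (\<exists>f. bij_betw f (vertices G) (vertices H) \<and>
          (\<forall>u\<in>vertices G. \<forall>v\<in>vertices G. {u, v} \<in> edges G \<longleftrightarrow> {f u, f v} \<in> edges H))"

definition contains_copy :: "'a graph \<Rightarrow> 'b graph \<Rightarrow> bool" where
  "contains_copy G H \<longleftrightarrow> (\<exists>K. subgraph K G \<and> isomorphic K H)"

(* The host graphs may be taken with natural numbers as vertices: every finite
   graph is isomorphic to one of these; see ramsey_propD below. *)
definition ramsey_prop :: "'a graph \<Rightarrow> 'b graph \<Rightarrow> nat \<Rightarrow> bool" where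
  "ramsey_prop G1 G2 N \<longleftrightarrow>
     (\<forall>G :: nat graph. simple_graph G \<and> card (vertices G) = N \<longrightarrow>
        contains_copy G G1 \<or> contains_copy (complement G) G2)"

definition ramsey_number :: "'a graph \<Rightarrow> 'b graph \<Rightarrow> nat" where
  "ramsey_number G1 G2 = (LEAST N. 0 < N \<and> ramsey_prop G1 G2 N)"

(* K_{1,k}: centre 0, leaves 1, ..., k; it has k + 1 vertices. *)
definition star :: "nat \<Rightarrow> nat graph" where
  "star k = ({0..k}, {{0, i} |i. i \<in> {1..k}})"

(* Inl i is v_i and Inr j is w_j. *)
definition double_star :: "nat \<Rightarrow> nat \<Rightarrow> (nat + nat) graph" where
  "double_star n1 n2 =
     (Inl ` {0..n1} \<union> Inr ` {0..n2},
      {{Inl 0, Inl i} |i. i \<in> {1..n1}} \<union> {{Inl 0, Inr 0}} \<union> {{Inr 0, Inr j} |j. j \<in> {1..n2}})"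

lemma simple_graph_star: "simple_graph (star k)"
  by (auto simp: simple_graph_def star_def nsets_def)

lemma simple_graph_double_star: "simple_graph (double_star n1 n2)"
  by (auto simp: simple_graph_def double_star_def nsets_def card_insert_if)

lemma contains_copy_transfer:
  assumes f: "inj_on f (vertices G)"
    and E: "\<And>u v. u \<in> vertices G \<Longrightarrow> v \<in> vertices G \<Longrightarrow>
      {u, v} \<in> edges G \<longleftrightarrow> {f u, f v} \<in> edges G'"
    and V: "vertices G' = f ` vertices G"
    and c: "contains_copy G' H"
  shows "contains_copy G H"
proof -
  obtain K g where K: "subgraph K G'" and g: "bij_betw g (vertices K) (vertices H)"
    and gE: "\<And>u v. u \<in> vertices K \<Longrightarrow> v \<in> vertices K \<Longrightarrow>
      {u, v} \<in> edges K \<longleftrightarrow> {g u, g v} \<in> edges H"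
    using c unfolding contains_copy_def isomorphic_def by blast
  define W where "W = {u \<in> vertices G. f u \<in> vertices K}"
  define L where "L = (W, {{u, v} |u v. u \<in> W \<and> v \<in> W \<and> {f u, f v} \<in> edges K})"
  have WK: "bij_betw f W (vertices K)"
    using f V K unfolding bij_betw_def W_def subgraph_def by (auto intro: inj_on_subset)
  have finK: "finite (vertices K)" and EK: "edges K \<subseteq> [vertices K]\<^bsup>2\<^esup>"
    using K unfolding subgraph_def simple_graph_def by auto
  have edgeL: "{u, v} \<in> edges L \<longleftrightarrow> {f u, f v} \<in> edges K" if "u \<in> W" "v \<in> W" for u v
    using that unfolding L_def by (auto simp: doubleton_eq_iff insert_commute)
  have "finite W" using WK finK by (simp add: bij_betw_finite)
  moreover have "edges L \<subseteq> [W]\<^bsup>2\<^esup>"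
  proof
    fix e assume "e \<in> edges L"
    then obtain u v where uv: "e = {u, v}" "u \<in> W" "v \<in> W" "{f u, f v} \<in> edges K"
      unfolding L_def by auto
    then have "card {f u, f v} = 2" using EK by (auto simp: nsets_def)
    then have "u \<noteq> v" by auto
    then show "e \<in> [W]\<^bsup>2\<^esup>" using uv by (auto simp: nsets_def)
  qed
  moreover have "edges L \<subseteq> edges G"
  proof
    fix e assume "e \<in> edges L"
    then obtain u v where uv: "e = {u, v}" "u \<in> W" "v \<in> W" "{f u, f v} \<in> edges K"
      unfolding L_def by auto
    then have "{f u, f v} \<in> edges G'" using K unfolding subgraph_def by auto
    then show "e \<in> edges G" using uv E unfolding W_def by auto
  qed
  ultimately have "subgraph L G"
    unfolding subgraph_def simple_graph_def by (auto simp: L_def W_def)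
  moreover have "isomorphic L H"
    unfolding isomorphic_def
  proof (intro exI conjI ballI)
    show "bij_betw (g \<circ> f) (vertices L) (vertices H)"
      using bij_betw_trans[OF WK g] by (simp add: L_def)
    fix u v assume "u \<in> vertices L" "v \<in> vertices L"
    then have uv: "u \<in> W" "v \<in> W" by (auto simp: L_def)
    then have "f u \<in> vertices K" "f v \<in> vertices K" by (auto simp: W_def)
    then show "{u, v} \<in> edges L \<longleftrightarrow> {(g \<circ> f) u, (g \<circ> f) v} \<in> edges H"
      using edgeL[OF uv] gE by simp
  qed
  ultimately show ?thesis unfolding contains_copy_def by blast
qed

lemma ramsey_propD:
  fixes G :: "'c graph"
  assumes r: "ramsey_prop G1 G2 N" and G: "simple_graph G" "card (vertices G) = N"
  shows "contains_copy G G1 \<or> contains_copy (complement G) G2"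
proof -
  have "finite (vertices G)" and EG: "edges G \<subseteq> [vertices G]\<^bsup>2\<^esup>"
    using G(1) by (auto simp: simple_graph_def)
  then obtain f :: "'c \<Rightarrow> nat" where f: "inj_on f (vertices G)"
    by (meson finite_imp_inj_to_nat_seg)
  define G' where "G' = (f ` vertices G, (`) f ` edges G)"
  have inj: "inj_on ((`) f) (Pow (vertices G))"
    using f by (rule inj_on_image_Pow)
  have E: "{u, v} \<in> edges G \<longleftrightarrow> {f u, f v} \<in> edges G'"
    if "u \<in> vertices G" "v \<in> vertices G" for u v
  proof -
    have "f ` {u, v} \<in> (`) f ` edges G \<longleftrightarrow> {u, v} \<in> edges G"
      by (rule inj_on_image_mem_iff[OF inj]) (use that EG in \<open>auto simp: nsets_def\<close>)
    then show ?thesis by (simp add: G'_def)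
  qed
  have sub: "f ` e \<in> [f ` vertices G]\<^bsup>2\<^esup>" if "e \<in> [vertices G]\<^bsup>2\<^esup>" for e
  proof -
    have "card (f ` e) = card e"
      by (rule card_image, rule inj_on_subset[OF f]) (use that in \<open>simp add: nsets_def\<close>)
    then show ?thesis using that by (simp add: nsets_def image_mono)
  qed
  have "(`) f ` edges G \<subseteq> [f ` vertices G]\<^bsup>2\<^esup>"
    using EG by (blast intro: sub)
  then have "simple_graph G'"
    using \<open>finite (vertices G)\<close> by (simp add: simple_graph_def G'_def)
  moreover have "card (vertices G') = N"
    using f G by (simp add: G'_def card_image)
  ultimately consider "contains_copy G' G1" | "contains_copy (complement G') G2"
    using r unfolding ramsey_prop_def by blast
  then show ?thesis
  proof cases
    case 1
    then show ?thesis
      using contains_copy_transfer[OF f, of G' G1] E by (simp add: G'_def)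
  next
    case 2
    have E': "{u, v} \<in> edges (complement G) \<longleftrightarrow> {f u, f v} \<in> edges (complement G')"
      if "u \<in> vertices (complement G)" "v \<in> vertices (complement G)" for u v
    proof -
      have uv: "u \<in> vertices G" "v \<in> vertices G" using that by (auto simp: complement_def)
      have "{u, v} \<in> [vertices G]\<^bsup>2\<^esup> \<longleftrightarrow> {f u, f v} \<in> [vertices G']\<^bsup>2\<^esup>"
        using uv inj_onD[OF f, of u v] by (auto simp: nsets_def G'_def card_insert_if)
      then show ?thesis using E[OF uv] by (simp add: complement_def)
    qed
    have "contains_copy (complement G) G2"
    proof (rule contains_copy_transfer[OF _ _ _ 2])
      show "inj_on f (vertices (complement G))" using f by (simp add: complement_def)
      show "vertices (complement G') = f ` vertices (complement G)"
        by (simp add: complement_def G'_def)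
    qed (rule E')
    then show ?thesis by simp
  qed
qed

end

theory Submission
  imports Defs
begin

text \<open>For the lower bound take a \<open>(m - 2)\<close>-regular circulant graph on \<open>m + n1 - 1\<close> vertices, which exists
  because \<open>m * n1\<close> is even; its complement is \<open>n1\<close>-regular, whereas \<open>v\<^sub>0\<close> has degree \<open>n1 + 1\<close>.

  For the upper bound let \<open>G\<close> have \<open>m + n1\<close> vertices and maximum degree at most \<open>m - 2\<close>. If the
  complement contains no double star, then any two non-adjacent vertices of \<open>G\<close> have at least
  \<open>d = m - 1 - n2\<close> common neighbours. Fix a vertex \<open>v\<close>. Counting the edges between its neighbours and
  its non-neighbours gives \<open>(n1 + 1) * d \<le> (m - 2) * (m - 3)\<close>, and since \<open>m - 2 = d + n2 - 1\<close> and
  \<open>m - 3 = d + n2 - 2\<close>, this contradicts the assumption on \<open>n1\<close>.\<close>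

section \<open>Copies as injective edge-preserving maps\<close>

text \<open>One direction inverts the isomorphism from the copy to \<open>H\<close>; the other takes
  the image of \<open>H\<close> as the copy. Simplicity of \<open>H\<close> makes every edge a pair
  of vertices, so the isomorphism condition, stated for pairs, reaches all edges.\<close>

lemma contains_copy_iff:
  assumes H: "simple_graph H"
  shows "contains_copy G H \<longleftrightarrow>
    (\<exists>f. inj_on f (vertices H) \<and> f ` vertices H \<subseteq> vertices G \<and> (\<forall>e\<in>edges H. f ` e \<in> edges G))"
proof
  assume "contains_copy G H"
  then obtain K g where K: "subgraph K G" and g: "bij_betw g (vertices K) (vertices H)"
    and gE: "\<And>u v. u \<in> vertices K \<Longrightarrow> v \<in> vertices K \<Longrightarrow>
      {u, v} \<in> edges K \<longleftrightarrow> {g u, g v} \<in> edges H"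
    unfolding contains_copy_def isomorphic_def by blast
  define f where "f = inv_into (vertices K) g"
  have f: "bij_betw f (vertices H) (vertices K)"
    unfolding f_def using g by (rule bij_betw_inv_into)
  have gf: "g (f x) = x" if "x \<in> vertices H" for x
    unfolding f_def using g that by (rule bij_betw_inv_into_right)
  have fV: "f x \<in> vertices K" if "x \<in> vertices H" for x
    using f that by (rule bij_betw_apply)
  have "f ` e \<in> edges G" if e: "e \<in> edges H" for e
  proof -
    have "e \<in> [vertices H]\<^bsup>2\<^esup>" using e H by (auto simp: simple_graph_def)
    then obtain x y where xy: "e = {x, y}" "x \<in> vertices H" "y \<in> vertices H"
      by (auto simp: nsets_def card_2_iff)
    then have "{f x, f y} \<in> edges K" using gE[OF fV fV, of x y] gf e by simp
    then show ?thesis using K xy by (auto simp: subgraph_def)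
  qed
  then show "\<exists>f. inj_on f (vertices H) \<and> f ` vertices H \<subseteq> vertices G \<and> (\<forall>e\<in>edges H. f ` e \<in> edges G)"
    using f K by (intro exI[of _ f]) (auto simp: bij_betw_def subgraph_def)
next
  assume "\<exists>f. inj_on f (vertices H) \<and> f ` vertices H \<subseteq> vertices G \<and> (\<forall>e\<in>edges H. f ` e \<in> edges G)"
  then obtain f where f: "inj_on f (vertices H)" "f ` vertices H \<subseteq> vertices G"
    "\<forall>e\<in>edges H. f ` e \<in> edges G" by blast
  define K where "K = (f ` vertices H, (`) f ` edges H)"
  have fin: "finite (vertices H)" and EH: "edges H \<subseteq> [vertices H]\<^bsup>2\<^esup>"
    using H by (auto simp: simple_graph_def)
  have "f ` e \<in> [f ` vertices H]\<^bsup>2\<^esup>" if "e \<in> edges H" for e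
  proof -
    have e: "e \<in> [vertices H]\<^bsup>2\<^esup>" using that EH by blast
    then have "card (f ` e) = card e"
      by (intro card_image inj_on_subset[OF f(1)]) (simp add: nsets_def)
    then show ?thesis using e by (simp add: nsets_def image_mono)
  qed
  then have "subgraph K G"
    using fin f by (auto simp: subgraph_def simple_graph_def K_def)
  moreover have "isomorphic K H"
    unfolding isomorphic_def
  proof (intro exI conjI ballI)
    let ?g = "inv_into (vertices H) f"
    show "bij_betw ?g (vertices K) (vertices H)"
      using f(1) by (simp add: K_def bij_betw_inv_into inj_on_imp_bij_betw)
    fix u v assume "u \<in> vertices K" "v \<in> vertices K"
    then obtain a b where ab: "u = f a" "v = f b" "a \<in> vertices H" "b \<in> vertices H"
      by (auto simp: K_def)
    \<comment> \<open>Injectivity on vertices carries over to sets of vertices, so no non-edge of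
      \<open>H\<close> has the same image as an edge.\<close>
    have "f ` {a, b} \<in> (`) f ` edges H \<longleftrightarrow> {a, b} \<in> edges H"
      by (rule inj_on_image_mem_iff[OF inj_on_image_Pow[OF f(1)]])
        (use ab EH in \<open>auto simp: nsets_def\<close>)
    then show "{u, v} \<in> edges K \<longleftrightarrow> {?g u, ?g v} \<in> edges H"
      using ab f(1) by (simp add: K_def)
  qed
  ultimately show "contains_copy G H" unfolding contains_copy_def by blast
qed

section \<open>Neighbourhoods and degrees\<close>

definition nbrs :: "'a graph \<Rightarrow> 'a \<Rightarrow> 'a set" where
  "nbrs G v = {u. {v, u} \<in> edges G}"

lemma nbrs_sym: "u \<in> nbrs G v \<longleftrightarrow> v \<in> nbrs G u"
  by (simp add: nbrs_def insert_commute)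

lemma nbrs_subset: "simple_graph G \<Longrightarrow> nbrs G v \<subseteq> vertices G - {v}"
  by (auto simp: nbrs_def simple_graph_def nsets_def card_insert_if)

lemma finite_nbrs: "simple_graph G \<Longrightarrow> finite (nbrs G v)"
  by (meson nbrs_subset finite_Diff finite_subset simple_graph_def)

lemma nbrs_complement:
  "v \<in> vertices G \<Longrightarrow> nbrs (complement G) v = vertices G - {v} - nbrs G v"
  by (auto simp: nbrs_def complement_def nsets_def card_insert_if)

lemma simple_graph_complement: "simple_graph G \<Longrightarrow> simple_graph (complement G)"
  by (auto simp: simple_graph_def complement_def)

text \<open>The vertex \<open>v\<close>, its neighbours and its non-neighbours partition the vertex
  set. The additive form avoids truncated subtraction.\<close>

lemma card_nbrs_complement:
  assumes G: "simple_graph G" and v: "v \<in> vertices G"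
  shows "card (nbrs (complement G) v) + card (nbrs G v) + 1 = card (vertices G)"
proof -
  have fin: "finite (vertices G)" using G by (simp add: simple_graph_def)
  have "card (vertices G - {v} - nbrs G v) = card (vertices G - {v}) - card (nbrs G v)"
    by (rule card_Diff_subset[OF finite_nbrs[OF G] nbrs_subset[OF G]])
  moreover have "card (nbrs G v) \<le> card (vertices G - {v})"
    using nbrs_subset[OF G] fin by (intro card_mono) auto
  moreover have "card (vertices G) > 0" using v fin by (auto simp: card_gt_0_iff)
  ultimately show ?thesis using v by (simp add: nbrs_complement)
qed

section \<open>Degree conditions for stars and double stars\<close>

lemma contains_copy_starI:
  assumes G: "simple_graph G" and v: "v \<in> vertices G" and k: "k \<le> card (nbrs G v)"
  shows "contains_copy G (star k)"
proof -
  obtain A where A: "A \<subseteq> nbrs G v" "finite A" "card A = k"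
    using obtain_subset_with_card_n[OF k] by metis
  obtain a where a: "bij_betw a {1..k} A"
    using finite_same_card_bij[of "{1..k}" A] A by auto
  have aA: "a i \<in> nbrs G v" if "i \<in> {1..k}" for i
    using bij_betw_apply[OF a that] A by auto
  define f where "f i = (if i = 0 then v else a i)" for i
  have notv: "a i \<noteq> v \<and> a i \<in> vertices G" if "i \<in> {1..k}" for i
    using aA[OF that] nbrs_subset[OF G] by blast
  have "inj_on f {0..k}"
  proof (rule inj_onI)
    fix i j assume ij: "i \<in> {0..k}" "j \<in> {0..k}" "f i = f j"
    then show "i = j"
      using inj_onD[OF bij_betw_imp_inj_on[OF a], of i j] notv[of i] notv[of j]
      by (auto simp: f_def split: if_splits)
  qed
  moreover have "f ` {0..k} \<subseteq> vertices G"
    using v notv by (auto simp: f_def)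
  moreover have "\<forall>e\<in>edges (star k). f ` e \<in> edges G"
    using aA by (auto simp: star_def f_def nbrs_def insert_commute)
  ultimately show ?thesis
    unfolding contains_copy_iff[OF simple_graph_star] by (auto simp: star_def)
qed

text \<open>An embedding sends the neighbours of \<open>x\<close> injectively to neighbours of its
  image. Hence an upper bound on all degrees of \<open>G\<close> excludes an \<open>H\<close> with a
  vertex of larger degree.\<close>

lemma contains_copy_card_nbrs:
  assumes H: "simple_graph H" and x: "x \<in> vertices H"
    and G: "simple_graph G" and c: "contains_copy G H"
  obtains v where "v \<in> vertices G" "card (nbrs H x) \<le> card (nbrs G v)"
proof -
  obtain f where f: "inj_on f (vertices H)" "f ` vertices H \<subseteq> vertices G"
    "\<forall>e\<in>edges H. f ` e \<in> edges G"
    using c unfolding contains_copy_iff[OF H] by blast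
  have "inj_on f (nbrs H x)"
    using nbrs_subset[OF H] by (intro inj_on_subset[OF f(1)]) blast
  moreover have "f ` nbrs H x \<subseteq> nbrs G (f x)"
    using f(3) by (force simp: nbrs_def)
  ultimately have "card (nbrs H x) \<le> card (nbrs G (f x))"
    using finite_nbrs[OF G] by (metis card_inj_on_le)
  then show ?thesis using that f(2) x by blast
qed

lemma card_nbrs_star: "card (nbrs (star k) 0) = k"
proof -
  have "nbrs (star k) 0 = {1..k}"
    by (auto simp: nbrs_def star_def doubleton_eq_iff)
  then show ?thesis by simp
qed

lemma card_nbrs_double_star: "card (nbrs (double_star n1 n2) (Inl 0)) = n1 + 1"
proof -
  have "nbrs (double_star n1 n2) (Inl 0) = insert (Inr 0) (Inl ` {1..n1})"
    by (auto simp: nbrs_def double_star_def doubleton_eq_iff)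
  then show ?thesis by (auto simp: card_image card_insert_if)
qed

text \<open>Hall's condition for two sets with demands \<open>a\<close> and \<open>b\<close>. The
  set \<open>B\<close> uses \<open>Y - X\<close> first and takes only the shortfall \<open>C\<close>
  from \<open>X \<inter> Y\<close>; then \<open>X - C\<close> still has
  \<open>card (X \<union> Y) - b\<close> elements, which is at least \<open>a\<close>.\<close>

lemma disjoint_subsets_with_cards:
  assumes fin: "finite X" "finite Y"
    and c: "a \<le> card X" "b \<le> card Y" "a + b \<le> card (X \<union> Y)"
  obtains A B where "A \<subseteq> X" "B \<subseteq> Y" "A \<inter> B = {}" "card A = a" "card B = b"
proof (cases "b \<le> card (Y - X)")
  case True
  obtain B where "B \<subseteq> Y - X" "card B = b" using obtain_subset_with_card_n[OF True] by metis
  moreover obtain A where "A \<subseteq> X" "card A = a" using obtain_subset_with_card_n[OF c(1)] by metis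
  ultimately show ?thesis using that[of A B] by blast
next
  case False
  have cY: "card Y = card (Y - X) + card (X \<inter> Y)"
    using fin by (metis Int_commute add.commute card_Int_Diff)
  have cU: "card (X \<union> Y) = card X + card (Y - X)"
    using fin by (metis Diff_disjoint Un_Diff_cancel card_Un_disjoint finite_Diff)
  have "b - card (Y - X) \<le> card (X \<inter> Y)" using c(2) cY by linarith
  then obtain C where C: "C \<subseteq> X \<inter> Y" "card C = b - card (Y - X)" "finite C"
    using obtain_subset_with_card_n by metis
  have "card (X - C) = card X - card C" using C by (intro card_Diff_subset) auto
  then have "a \<le> card (X - C)" using C(2) c(3) cU False by linarith
  then obtain A where A: "A \<subseteq> X - C" "card A = a" using obtain_subset_with_card_n by metis
  have "card ((Y - X) \<union> C) = card (Y - X) + card C"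
    using C fin by (intro card_Un_disjoint) auto
  then have "card ((Y - X) \<union> C) = b" using C(2) False by linarith
  then show ?thesis using that[of A "(Y - X) \<union> C"] A C by blast
qed

text \<open>With centres \<open>v\<close> and \<open>w\<close>, the task is to choose disjoint leaf
  sets in the two neighbourhoods; the three bounds are exactly what
  \<open>disjoint_subsets_with_cards\<close> needs.\<close>

lemma contains_copy_double_starI:
  assumes G: "simple_graph G" and vw: "w \<in> nbrs G v"
    and c: "n1 \<le> card (nbrs G v - {w})" "n2 \<le> card (nbrs G w - {v})"
      "n1 + n2 \<le> card ((nbrs G v - {w}) \<union> (nbrs G w - {v}))"
  shows "contains_copy G (double_star n1 n2)"
proof -
  obtain A B where AB: "A \<subseteq> nbrs G v - {w}" "B \<subseteq> nbrs G w - {v}" "A \<inter> B = {}"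
    "card A = n1" "card B = n2"
    by (rule disjoint_subsets_with_cards[OF _ _ c]) (simp_all add: finite_nbrs[OF G])
  have fin: "finite A" "finite B"
    using AB(1,2) finite_nbrs[OF G] by (meson finite_Diff finite_subset)+
  obtain a where a: "bij_betw a {1..n1} A"
    using finite_same_card_bij[of "{1..n1}" A] AB fin by auto
  obtain b where b: "bij_betw b {1..n2} B"
    using finite_same_card_bij[of "{1..n2}" B] AB fin by auto
  have aA: "a i \<in> A" if "i \<in> {1..n1}" for i using bij_betw_apply[OF a that] .
  have bB: "b i \<in> B" if "i \<in> {1..n2}" for i using bij_betw_apply[OF b that] .
  have v: "v \<in> vertices G" "w \<in> vertices G" "v \<noteq> w"
    using vw nbrs_subset[OF G] nbrs_sym[of w G v] by blast+
  have A: "x \<noteq> v \<and> x \<noteq> w \<and> x \<in> vertices G \<and> {v, x} \<in> edges G" if "x \<in> A" for x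
    using that AB(1) nbrs_subset[OF G, of v] by (auto simp: nbrs_def)
  have B: "x \<noteq> v \<and> x \<noteq> w \<and> x \<in> vertices G \<and> {w, x} \<in> edges G" if "x \<in> B" for x
    using that AB(2) nbrs_subset[OF G, of w] by (auto simp: nbrs_def)
  define f where "f = case_sum (\<lambda>i. if i = 0 then v else a i) (\<lambda>j. if j = 0 then w else b j)"
  have injl: "inj_on (\<lambda>i. if i = 0 then v else a i) {0..n1}"
  proof (rule inj_onI)
    fix i j assume "i \<in> {0..n1}" "j \<in> {0..n1}"
      "(if i = 0 then v else a i) = (if j = 0 then v else a j)"
    then show "i = j"
      using inj_onD[OF bij_betw_imp_inj_on[OF a], of i j] A aA[of i] aA[of j]
      by (auto split: if_splits)
  qed
  have injr: "inj_on (\<lambda>i. if i = 0 then w else b i) {0..n2}"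
  proof (rule inj_onI)
    fix i j assume "i \<in> {0..n2}" "j \<in> {0..n2}"
      "(if i = 0 then w else b i) = (if j = 0 then w else b j)"
    then show "i = j"
      using inj_onD[OF bij_betw_imp_inj_on[OF b], of i j] B bB[of i] bB[of j]
      by (auto split: if_splits)
  qed
  have cross: "(if i = 0 then v else a i) \<noteq> (if j = 0 then w else b j)"
    if "i \<in> {0..n1}" "j \<in> {0..n2}" for i j
  proof -
    have "i = 0 \<or> a i \<in> A" "j = 0 \<or> b j \<in> B" using that aA[of i] bB[of j] by (cases i; cases j; auto)+
    then show ?thesis using A B v AB(3) by auto
  qed
  have edge: "i \<in> {1..n1} \<Longrightarrow> {v, a i} \<in> edges G"
    "j \<in> {1..n2} \<Longrightarrow> {w, b j} \<in> edges G" for i j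
    using A[OF aA] B[OF bB] by blast+
  have "inj_on f (vertices (double_star n1 n2))"
  proof (rule inj_onI)
    fix x y assume "x \<in> vertices (double_star n1 n2)" "y \<in> vertices (double_star n1 n2)" "f x = f y"
    then have V: "x \<in> Inl ` {0..n1} \<union> Inr ` {0..n2}" "y \<in> Inl ` {0..n1} \<union> Inr ` {0..n2}"
      and eq: "f x = f y" by (simp_all add: double_star_def)
    show "x = y"
    proof (cases x)
      case x: (Inl i)
      show ?thesis
      proof (cases y)
        case (Inl j)
        then show ?thesis using inj_onD[OF injl, of i j] x V eq by (auto simp: f_def)
      next
        case (Inr j)
        then show ?thesis using cross[of i j] x V eq by (auto simp: f_def)
      qed
    next
      case x: (Inr i)
      show ?thesis
      proof (cases y)
        case (Inl j)
        then show ?thesis using cross[of j i] x V eq by (auto simp: f_def)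
      next
        case (Inr j)
        then show ?thesis using inj_onD[OF injr, of i j] x V eq by (auto simp: f_def)
      qed
    qed
  qed
  moreover have "f ` vertices (double_star n1 n2) \<subseteq> vertices G"
    using A B aA bB v by (auto simp: f_def double_star_def)
  moreover have "\<forall>e\<in>edges (double_star n1 n2). f ` e \<in> edges G"
    using edge vw by (auto simp: f_def double_star_def nbrs_def insert_commute)
  ultimately show ?thesis
    unfolding contains_copy_iff[OF simple_graph_double_star] by blast
qed

section \<open>Monotonicity of the Ramsey property\<close>

lemma contains_copy_mono:
  assumes "contains_copy L H" "vertices L \<subseteq> vertices G" "edges L \<subseteq> edges G"
  shows "contains_copy G H"
  using assms unfolding contains_copy_def subgraph_def by blast

text \<open>Restrict to \<open>M\<close> of the vertices. This lets a single counterexample rule out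
  all smaller orders.\<close>

lemma ramsey_prop_mono:
  assumes r: "ramsey_prop G1 G2 M" and le: "M \<le> N"
  shows "ramsey_prop G1 G2 N"
  unfolding ramsey_prop_def
proof (intro allI impI)
  fix G :: "nat graph" assume G: "simple_graph G \<and> card (vertices G) = N"
  then obtain W where W: "W \<subseteq> vertices G" "card W = M" "finite W"
    using obtain_subset_with_card_n le by metis
  \<comment> \<open>The subgraph is induced, so that non-edges of \<open>L\<close> are non-edges of
    \<open>G\<close> and copies in the complement carry over too.\<close>
  define L where "L = (W, edges G \<inter> [W]\<^bsup>2\<^esup>)"
  have "contains_copy L G1 \<or> contains_copy (complement L) G2"
    using r W unfolding ramsey_prop_def by (auto simp: L_def simple_graph_def)
  moreover have "vertices L \<subseteq> vertices G" "edges L \<subseteq> edges G"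
    "vertices (complement L) \<subseteq> vertices (complement G)"
    "edges (complement L) \<subseteq> edges (complement G)"
    using W nsets_mono[of W "vertices G" 2] by (auto simp: L_def complement_def)
  ultimately show "contains_copy G G1 \<or> contains_copy (complement G) G2"
    by (meson contains_copy_mono)
qed

section \<open>Regular circulant graphs and the lower bound\<close>

text \<open>Join each residue modulo \<open>N\<close> to its translates by \<open>S\<close>. As
  \<open>S\<close> is closed under negation, the neighbourhood of \<open>v\<close> is just the
  translate of \<open>S\<close> by \<open>v\<close>, and translation is injective.\<close>

lemma circulant_graph:
  assumes S: "S \<subseteq> {1..<N}" and sym: "\<And>s. s \<in> S \<Longrightarrow> N - s \<in> S"
  obtains G :: "nat graph" where "simple_graph G" "vertices G = {..<N}"
    "\<And>v. v < N \<Longrightarrow> card (nbrs G v) = card S"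
proof -
  define t where "t i s = (i + s) mod N" for i s
  define G where "G = ({..<N}, {{i, t i s} |i s. i < N \<and> s \<in> S})"
  \<comment> \<open>The sum is below \<open>2 * N\<close>, so reduction subtracts \<open>N\<close>
    at most once.\<close>
  have t_eq: "t i s = (if i + s < N then i + s else i + s - N)" if "i < N" "s < N" for i s
    using that by (simp add: t_def le_mod_geq)
  have tneq: "t i s \<noteq> i" "t i s < N" "t (t i s) (N - s) = i" if "i < N" "s \<in> S" for i s
  proof -
    have s: "1 \<le> s" "s < N" using that S by auto
    then show "t i s \<noteq> i" "t i s < N"
      using that(1) t_eq[of i s] by auto
    have "t (t i s) (N - s) = (i + s + (N - s)) mod N"
      unfolding t_def by (rule mod_add_left_eq)
    then show "t (t i s) (N - s) = i" using s that(1) by simp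
  qed
  have "simple_graph G"
    using tneq(1,2) by (fastforce simp: simple_graph_def G_def nsets_def card_insert_if)
  moreover have "vertices G = {..<N}" by (simp add: G_def)
  moreover have "card (nbrs G v) = card S" if v: "v < N" for v
  proof -
    have "nbrs G v = t v ` S"
    proof
      show "t v ` S \<subseteq> nbrs G v" using v by (auto simp: nbrs_def G_def)
      show "nbrs G v \<subseteq> t v ` S"
      proof
        fix u assume "u \<in> nbrs G v"
        then obtain i s where ist: "{v, u} = {i, t i s}" "i < N" "s \<in> S"
          by (auto simp: nbrs_def G_def)
        then consider "v = i" "u = t i s" | "v = t i s" "u = i" by (auto simp: doubleton_eq_iff)
        then show "u \<in> t v ` S"
        proof cases
          case 2
          \<comment> \<open>Here the edge was generated from its other end; going back by
            \<open>s\<close> is going forward by \<open>N - s\<close>, which is again in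
            \<open>S\<close>.\<close>
          then have "u = t v (N - s)" using tneq(3) ist by simp
          then show ?thesis using sym ist by blast
        qed (use ist in blast)
      qed
    qed
    moreover have "inj_on (t v) S"
    proof (rule inj_onI)
      fix x y assume xy: "x \<in> S" "y \<in> S" "t v x = t v y"
      then have "x < N" "y < N" using S by auto
      then show "x = y" using xy(3) t_eq[of v x] t_eq[of v y] v
        by (auto split: if_splits)
    qed
    ultimately show ?thesis by (simp add: card_image)
  qed
  ultimately show ?thesis using that by blast
qed

text \<open>Take the \<open>k div 2\<close> smallest and the \<open>k div 2\<close> largest nonzero
  residues, which negation exchanges. If \<open>k\<close> is odd then \<open>N\<close> is even, and
  \<open>N div 2\<close>, its own negative, supplies the missing element.\<close>

lemma symmetric_difference_set:
  fixes k N :: nat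
  assumes "k < N" "even (k * N)"
  obtains S where "S \<subseteq> {1..<N}" "\<And>s. s \<in> S \<Longrightarrow> N - s \<in> S" "card S = k"
proof -
  define h where "h = k div 2"
  define T where "T = {1..h} \<union> {N - h..<N}"
  have h: "2 * h < N" using assms(1) by (auto simp: h_def)
  have fin: "finite T" by (simp add: T_def)
  have "card T = h + h"
    unfolding T_def using h by (subst card_Un_disjoint) auto
  moreover have T: "T \<subseteq> {1..<N}" using h by (auto simp: T_def)
  moreover have symT: "N - s \<in> T" if "s \<in> T" for s using that h by (auto simp: T_def)
  ultimately show ?thesis
  proof (cases "even k")
    case True
    then have "h + h = k" by (auto simp: h_def)
    then show ?thesis using that[of T] T symT \<open>card T = h + h\<close> by blast
  next
    case False
    then have k: "k = h + h + 1" by (auto simp: h_def elim: oddE)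
    have "even N" using assms(2) False by simp
    then obtain c where c: "N = 2 * c" by (elim evenE)
    have "c \<notin> T" using assms(1) c k by (auto simp: T_def)
    then have "card (insert c T) = k" using fin k \<open>card T = h + h\<close> by simp
    moreover have "insert c T \<subseteq> {1..<N}" using T c h by auto
    moreover have "N - s \<in> insert c T" if "s \<in> insert c T" for s
      using that symT c by auto
    ultimately show ?thesis using that[of "insert c T"] by blast
  qed
qed

lemma regular_graph:
  fixes k N :: nat
  assumes "k < N" "even (k * N)"
  obtains G :: "nat graph" where "simple_graph G" "vertices G = {..<N}"
    "\<And>v. v < N \<Longrightarrow> card (nbrs G v) = k"
  using symmetric_difference_set[OF assms] circulant_graph by metis

text \<open>The degrees in the complement are \<open>(m + n1 - 1) - 1 - (m - 2) = n1\<close>, one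
  too few for the centre \<open>Inl 0\<close>.\<close>

lemma not_ramsey_prop_star_double_star:
  assumes "2 \<le> m" "even (m * n1)" "0 < n1"
  shows "\<not> ramsey_prop (star (m - 1)) (double_star n1 n2) (m + n1 - 1)"
proof
  assume r: "ramsey_prop (star (m - 1)) (double_star n1 n2) (m + n1 - 1)"
  \<comment> \<open>If \<open>m\<close> is odd then \<open>n1\<close> is even, which makes
    \<open>m + n1 - 1\<close> even; otherwise \<open>m - 2\<close> is even.\<close>
  have ev: "even ((m - 2) * (m + n1 - 1))" using assms by auto
  have lt: "m - 2 < m + n1 - 1" using assms by linarith
  obtain G :: "nat graph" where G: "simple_graph G" "vertices G = {..<m + n1 - 1}"
    "\<And>v. v < m + n1 - 1 \<Longrightarrow> card (nbrs G v) = m - 2"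
    using regular_graph[OF lt ev] by metis
  have "contains_copy G (star (m - 1)) \<or> contains_copy (complement G) (double_star n1 n2)"
    using ramsey_propD[OF r G(1)] G(2) by simp
  then show False
  proof
    assume "contains_copy G (star (m - 1))"
    then obtain v where "v \<in> vertices G" "m - 1 \<le> card (nbrs G v)"
      using contains_copy_card_nbrs[OF simple_graph_star _ G(1), of 0 "m - 1"]
      by (auto simp: card_nbrs_star) (auto simp: star_def)
    then show False using G assms(1) by auto
  next
    assume "contains_copy (complement G) (double_star n1 n2)"
    then obtain v where v: "v \<in> vertices (complement G)" "n1 + 1 \<le> card (nbrs (complement G) v)"
      using contains_copy_card_nbrs[OF simple_graph_double_star _ simple_graph_complement[OF G(1)],
          of "Inl 0" n1 n2]
      by (auto simp: card_nbrs_double_star) (auto simp: double_star_def)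
    then have "v \<in> vertices G" by (simp add: complement_def)
    then show False
      using card_nbrs_complement[OF G(1)] v G(2) G(3)[of v] assms by fastforce
  qed
qed

section \<open>Double counting and the upper bound\<close>

text \<open>Count the edges between neighbours and non-neighbours of \<open>v\<close>: each
  non-neighbour lies on at least \<open>d\<close> of them, and each neighbour on at most
  \<open>D - 1\<close>.\<close>

lemma count_nbrs_nonnbrs:
  assumes G: "simple_graph G" and v: "v \<in> vertices G"
    and D: "\<And>u. u \<in> vertices G \<Longrightarrow> card (nbrs G u) \<le> D"
    and d: "\<And>w. w \<in> nbrs (complement G) v \<Longrightarrow> d \<le> card (nbrs G v \<inter> nbrs G w)"
  shows "card (nbrs (complement G) v) * d \<le> card (nbrs G v) * (D - 1)"
proof -
  let ?W = "nbrs (complement G) v"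
  have finW: "finite ?W" by (rule finite_nbrs[OF simple_graph_complement[OF G]])
  have finN: "finite (nbrs G u)" for u by (rule finite_nbrs[OF G])
  have "card ?W * d \<le> (\<Sum>w\<in>?W. card {u \<in> nbrs G v. u \<in> nbrs G w})"
    using sum_mono[of ?W "\<lambda>_. d" "\<lambda>w. card (nbrs G v \<inter> nbrs G w)"] d by (simp add: Int_def)
  also have "\<dots> = (\<Sum>u\<in>nbrs G v. card {w \<in> ?W. u \<in> nbrs G w})"
    by (rule sum_multicount_gen[symmetric, OF finN finW]) simp
  also have "\<dots> \<le> (\<Sum>u\<in>nbrs G v. D - 1)"
  proof (rule sum_mono)
    fix u assume u: "u \<in> nbrs G v"
    \<comment> \<open>The edge from \<open>u\<close> back to \<open>v\<close> is not counted, which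
      accounts for the \<open>- 1\<close>.\<close>
    then have "{w \<in> ?W. u \<in> nbrs G w} \<subseteq> nbrs G u - {v}"
      using nbrs_subset[OF simple_graph_complement[OF G], of v] nbrs_sym[of u G] by blast
    then have "card {w \<in> ?W. u \<in> nbrs G w} \<le> card (nbrs G u - {v})"
      using finN by (intro card_mono) auto
    also have "\<dots> = card (nbrs G u) - 1"
      using u nbrs_sym[of u G v] by simp
    also have "\<dots> \<le> D - 1"
      using D u nbrs_subset[OF G, of v] by (intro diff_le_mono) blast
    finally show "card {w \<in> ?W. u \<in> nbrs G w} \<le> D - 1" .
  qed
  finally show ?thesis by simp
qed

text \<open>The hypothesis \<open>lt\<close> contradicts the double count with
  \<open>D = m - 2\<close> and \<open>d = m - 1 - n2\<close>.\<close>

lemma ramsey_prop_star_double_star: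
  assumes n: "n2 \<le> n1" "n2 + 2 \<le> m"
    and lt: "(m - 2) * (m - 3) < (n1 + 1) * (m - 1 - n2)"
  shows "ramsey_prop (star (m - 1)) (double_star n1 n2) (m + n1)"
  unfolding ramsey_prop_def
proof (intro allI impI)
  fix G :: "nat graph" assume "simple_graph G \<and> card (vertices G) = m + n1"
  then have G: "simple_graph G" and cG: "card (vertices G) = m + n1" by auto
  let ?H = "complement G"
  have H: "simple_graph ?H" by (rule simple_graph_complement[OF G])
  have VH: "vertices ?H = vertices G" by (simp add: complement_def)
  show "contains_copy G (star (m - 1)) \<or> contains_copy ?H (double_star n1 n2)"
  proof (rule ccontr)
    assume "\<not> ?thesis"
    then have ns: "\<not> contains_copy G (star (m - 1))"
      and nd: "\<not> contains_copy ?H (double_star n1 n2)" by auto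
    have deg: "card (nbrs G u) \<le> m - 2" if "u \<in> vertices G" for u
      using contains_copy_starI[OF G that, of "m - 1"] ns by linarith
    have degH: "n1 + 1 \<le> card (nbrs ?H u)" if "u \<in> vertices G" for u
      using card_nbrs_complement[OF G that] cG deg[OF that] n by linarith
    have "vertices G \<noteq> {}" using cG n by auto
    then obtain v where v: "v \<in> vertices G" by blast
    have fin: "finite (vertices G)" using G by (simp add: simple_graph_def)
    have common: "m - 1 - n2 \<le> card (nbrs G v \<inter> nbrs G w)" if w: "w \<in> nbrs ?H v" for w
    proof -
      have wV: "w \<in> vertices G" "w \<noteq> v" using w nbrs_subset[OF H] VH by blast+
      have vw: "v \<in> nbrs ?H w" using w by (simp add: nbrs_sym)
      have "n1 \<le> card (nbrs ?H v - {w})" "n2 \<le> card (nbrs ?H w - {v})"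
        using degH[OF v] degH[OF wV(1)] w vw n(1) by auto
      \<comment> \<open>Two of the three conditions for a double star centred at \<open>v\<close>
        and \<open>w\<close> hold, so the third must fail.\<close>
      then have less: "card ((nbrs ?H v - {w}) \<union> (nbrs ?H w - {v})) < n1 + n2"
        using contains_copy_double_starI[OF H w] nd by (meson not_le)
      \<comment> \<open>A third vertex adjacent in \<open>?H\<close> to neither \<open>v\<close> nor
        \<open>w\<close> is a common neighbour of both in \<open>G\<close>.\<close>
      have "vertices G - {v, w} \<subseteq>
          ((nbrs ?H v - {w}) \<union> (nbrs ?H w - {v})) \<union> (nbrs G v \<inter> nbrs G w)"
        using v wV by (auto simp: nbrs_complement)
      then have "card (vertices G - {v, w}) \<le>
          card (((nbrs ?H v - {w}) \<union> (nbrs ?H w - {v})) \<union> (nbrs G v \<inter> nbrs G w))"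
        using finite_nbrs[OF G] finite_nbrs[OF H] by (intro card_mono) auto
      also have "\<dots> \<le> card ((nbrs ?H v - {w}) \<union> (nbrs ?H w - {v})) + card (nbrs G v \<inter> nbrs G w)"
        by (rule card_Un_le)
      finally have "card (vertices G - {v, w}) < n1 + n2 + card (nbrs G v \<inter> nbrs G w)"
        using less by linarith
      moreover have "card (vertices G - {v, w}) = m + n1 - 2"
        using v wV cG by (subst card_Diff_subset) auto
      \<comment> \<open>The strict bound \<open>m + n1 - 2 < n1 + n2 + c\<close> for the number
        \<open>c\<close> of common neighbours gives \<open>c >= m - 1 - n2\<close>.\<close>
      ultimately show ?thesis using n by linarith
    qed
    have "(n1 + 1) * (m - 1 - n2) \<le> card (nbrs ?H v) * (m - 1 - n2)"
      using degH[OF v] by (rule mult_le_mono1)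
    also have "\<dots> \<le> card (nbrs G v) * (m - 2 - 1)"
      by (rule count_nbrs_nonnbrs[OF G v deg common])
    also have "\<dots> \<le> (m - 2) * (m - 3)"
      using deg[OF v] by (intro mult_le_mono) auto
    finally show False using lt by simp
  qed
qed

section \<open>Arithmetic of the hypothesis and the exact value\<close>

theorem theorem4p1:
  fixes m n1 n2 :: nat
  assumes "m > 0" and "n1 > 0" and "n2 > 0"
    and "n1 \<ge> m - 2" and "m - 2 \<ge> n2" and "n2 \<ge> 2"
    and "2 dvd m * n1"
    and "real n1 > real m - 5 + real n2 + (real n2 - 1) * (real n2 - 2) / (real m - 1 - real n2)"
  shows "ramsey_number (star (m - 1)) (double_star n1 n2) = m + n1"
proof -
  have m: "n2 + 2 \<le> m" "n2 \<le> n1" using assms by linarith+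
  define d where "d = m - 1 - n2"
  have d: "real m = real d + real n2 + 1" "d > 0" using m by (auto simp: d_def)
  have "real d * ((real n2 - 1) * (real n2 - 2) / real d) = (real n2 - 1) * (real n2 - 2)"
    using d by simp
  \<comment> \<open>Since \<open>m = d + n2 + 1\<close>, the term \<open>m - 5 + n2\<close> is
    \<open>d + 2 * n2 - 4\<close>; multiplying by \<open>d > 0\<close> clears the
    denominator.\<close>
  moreover have "real d * (real d + 2 * real n2 - 4 + (real n2 - 1) * (real n2 - 2) / real d)
      < real d * real n1"
    using assms(8) d by (intro mult_strict_left_mono) (auto simp: algebra_simps)
  \<comment> \<open>The left side expands to
    \<open>d * (d + 2 * n2 - 4) + (n2 - 1) * (n2 - 2) + d\<close>; the last \<open>d\<close> is
    matched by the \<open>1\<close> in \<open>n1 + 1\<close>.\<close>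
  ultimately have "(real d + real n2 - 1) * (real d + real n2 - 2) < (real n1 + 1) * real d"
    by (simp add: algebra_simps)
  \<comment> \<open>Since \<open>m >= 4\<close>, the natural subtractions do not truncate.\<close>
  moreover have "real (m - 2) = real d + real n2 - 1" "real (m - 3) = real d + real n2 - 2"
    using d assms(6) m by auto
  ultimately have "real ((m - 2) * (m - 3)) < real ((n1 + 1) * d)"
    by (simp only: of_nat_mult of_nat_add of_nat_1)
  then have "(m - 2) * (m - 3) < (n1 + 1) * (m - 1 - n2)"
    unfolding d_def of_nat_less_iff .
  then have upper: "ramsey_prop (star (m - 1)) (double_star n1 n2) (m + n1)"
    using m by (intro ramsey_prop_star_double_star)
  have "\<not> ramsey_prop (star (m - 1)) (double_star n1 n2) (m + n1 - 1)"
    using assms m by (intro not_ramsey_prop_star_double_star) auto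
  then have lower: "m + n1 \<le> N" if "ramsey_prop (star (m - 1)) (double_star n1 n2) N" for N
    using ramsey_prop_mono[OF that, of "m + n1 - 1"]
    by linarith
  show ?thesis
    unfolding ramsey_number_def
    by (rule Least_equality) (use upper lower assms(1) in auto)
qed

end
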